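(* Let $(x_n)_{n\in\mathbb{N}}$ be a sequence of nonnegative real numbers with $x_0<K$, and suppose that the functional $\Gamma(\varepsilon,g,N)\in\mathbb{N}$ satisfies $$\forall\varepsilon>0,\ \forall N\in\mathbb{N},\ \forall g:\mathbb{N}\to\mathbb{N}\ \ \exists n\le\Gamma(\varepsilon,g,N)\ \forall i\in[n,n+g(n)]\ (x_i\le x_N+\varepsilon).$$ Define $$\Phi(\varepsilon,g):=\Gamma^\ast\left(\tfrac\varepsilon2,g,f^{(\lceil 2K/\varepsilon\rceil)}(0)\right),\qquad f(j):=\Gamma^\ast(\tfrac\varepsilon2,g,j)+g^\ast\left(\Gamma^\ast(\tfrac\varepsilon2,g,j)\right).$$ Then $\Phi$ is a rate of metastability for $(x_n)_{n\in\mathbb{N}}$, i.e. $$\forall\varepsilon>0,\ \forall g:\mathbb{N}\to\mathbb{N}\ \ \exists n\le\Phi(\varepsilon,g)\ \forall i,j\in[n,n+g(n)]\ (|x_i-x_j|\le\varepsilon).$$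
   Context: $\mathbb{N}$ includes $0$; $[n,m]$ denotes the set of natural numbers $i$ with $n\le i\le m$. For $g:\mathbb{N}\to\mathbb{N}$, $g^\ast(n):=\max(\{n\}\cup\{g(i):i\le n\})$. Likewise $\Gamma^\ast(\varepsilon,g,N):=\max(\{N\}\cup\{\Gamma(\varepsilon,g,i):i\le N\})$. $f^{(m)}$ denotes the $m$-fold iterate of $f$. *)

theory Defs
  imports Complex_Main
begin

definition nat_star :: "(nat \<Rightarrow> nat) \<Rightarrow> nat \<Rightarrow> nat" where
  "nat_star g n = Max ({n} \<union> {g i | i. i \<le> n})"

definition functional_star ::
    "(real \<Rightarrow> (nat \<Rightarrow> nat) \<Rightarrow> nat \<Rightarrow> nat) \<Rightarrow> real \<Rightarrow> (nat \<Rightarrow> nat) \<Rightarrow> nat \<Rightarrow> nat" where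
  "functional_star \<Gamma> \<epsilon> g N = Max ({N} \<union> {\<Gamma> \<epsilon> g i | i. i \<le> N})"

definition step_fun ::
    "(real \<Rightarrow> (nat \<Rightarrow> nat) \<Rightarrow> nat \<Rightarrow> nat) \<Rightarrow> real \<Rightarrow> (nat \<Rightarrow> nat) \<Rightarrow> nat \<Rightarrow> nat" where
  "step_fun \<Gamma> \<epsilon> g j =
     functional_star \<Gamma> (\<epsilon> / 2) g j + nat_star g (functional_star \<Gamma> (\<epsilon> / 2) g j)"

(* For K, \<epsilon> > 0 the ceiling is positive, so the conversion to nat loses nothing. *)
definition Phi ::
    "real \<Rightarrow> (real \<Rightarrow> (nat \<Rightarrow> nat) \<Rightarrow> nat \<Rightarrow> nat) \<Rightarrow> real \<Rightarrow> (nat \<Rightarrow> nat) \<Rightarrow> nat" where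
  "Phi K \<Gamma> \<epsilon> g =
     functional_star \<Gamma> (\<epsilon> / 2) g ((step_fun \<Gamma> \<epsilon> g ^^ nat \<lceil>2 * K / \<epsilon>\<rceil>) 0)"

definition metastability_rate ::
    "(real \<Rightarrow> (nat \<Rightarrow> nat) \<Rightarrow> nat) \<Rightarrow> (nat \<Rightarrow> real) \<Rightarrow> bool" where
  "metastability_rate \<Psi> x \<longleftrightarrow>
     (\<forall>\<epsilon>>0. \<forall>g :: nat \<Rightarrow> nat. \<exists>n\<le>\<Psi> \<epsilon> g.
        \<forall>i\<in>{n..n + g n}. \<forall>j\<in>{n..n + g n}. \<bar>x i - x j\<bar> \<le> \<epsilon>)"

end

theory Submission
  imports Defs
begin

text \<open>Suppose there is no point of metastability below the bound. The hypothesis, applied at an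
  index \<open>N\<close>, keeps the sequence below \<open>x N + \<epsilon>/2\<close> on a window whose start lies within the bound;
  since its oscillation there exceeds \<open>\<epsilon>\<close>, it drops below \<open>x N - \<epsilon>/2\<close> at some index of
  that window. Iterating from \<open>N = 0\<close>, after \<open>\<lceil>2K/\<epsilon>\<rceil>\<close> steps the sequence has become negative.\<close>

lemma nat_star_ge:
  assumes "i \<le> n"
  shows "g i \<le> nat_star g n"
  unfolding nat_star_def using assms by (intro Max_ge) auto

lemma functional_star_ge_arg: "N \<le> functional_star \<Gamma> \<epsilon> g N"
  unfolding functional_star_def by (intro Max_ge) auto

lemma functional_star_ge:
  assumes "i \<le> N"
  shows "\<Gamma> \<epsilon> g i \<le> functional_star \<Gamma> \<epsilon> g N"
  unfolding functional_star_def using assms by (intro Max_ge) auto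

text \<open>\<open>\<Gamma>\<close> need not be monotone in its last argument; its running maximum
  is, so the bounds of all stages can be compared with the final one.\<close>

lemma functional_star_mono:
  assumes "M \<le> N"
  shows "functional_star \<Gamma> \<epsilon> g M \<le> functional_star \<Gamma> \<epsilon> g N"
proof -
  have "i \<le> functional_star \<Gamma> \<epsilon> g N" if "i \<in> {M} \<union> {\<Gamma> \<epsilon> g i | i. i \<le> M}" for i
    using that assms functional_star_ge_arg[of N \<Gamma> \<epsilon> g] by (auto intro: functional_star_ge)
  then show ?thesis
    unfolding functional_star_def[of \<Gamma> \<epsilon> g M] by (intro Max.boundedI) auto
qed

lemma step_fun_ge_arg: "j \<le> step_fun \<Gamma> \<epsilon> g j"
  unfolding step_fun_def using functional_star_ge_arg by (rule trans_le_add1)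

theorem theorem2p5:
  fixes x :: "nat \<Rightarrow> real" and K :: real
    and \<Gamma> :: "real \<Rightarrow> (nat \<Rightarrow> nat) \<Rightarrow> nat \<Rightarrow> nat"
  assumes "\<And>n. 0 \<le> x n"
    and "x 0 < K"
    and "\<forall>\<epsilon>>0. \<forall>N :: nat. \<forall>g :: nat \<Rightarrow> nat. \<exists>n\<le>\<Gamma> \<epsilon> g N.
           \<forall>i\<in>{n..n + g n}. x i \<le> x N + \<epsilon>"
  shows "metastability_rate (Phi K \<Gamma>) x"
  unfolding metastability_rate_def
proof (intro allI impI, rule ccontr)
  fix \<epsilon> :: real and g :: "nat \<Rightarrow> nat"
  assume "0 < \<epsilon>"
    and unstable: "\<not> (\<exists>n\<le>Phi K \<Gamma> \<epsilon> g.
          \<forall>i\<in>{n..n + g n}. \<forall>j\<in>{n..n + g n}. \<bar>x i - x j\<bar> \<le> \<epsilon>)"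
  define m where "m = nat \<lceil>2 * K / \<epsilon>\<rceil>"
  define M where "M k = (step_fun \<Gamma> \<epsilon> g ^^ k) 0" for k
  let ?G = "functional_star \<Gamma> (\<epsilon> / 2) g"
  have M_Suc: "M (Suc k) = ?G (M k) + nat_star g (?G (M k))" for k
    by (simp add: M_def step_fun_def)
  have M_mono: "mono M"
    by (simp add: mono_iff_le_Suc M_def step_fun_ge_arg)
  \<comment> \<open>\<open>M k\<close> bounds the index reached after \<open>k\<close> drops, each
    of more than \<open>\<epsilon> / 2\<close>.\<close>
  have "\<exists>N\<le>M k. x N < K - real k * (\<epsilon> / 2)" if "k \<le> m" for k
    using that
  proof (induction k)
    case 0
    then show ?case using \<open>x 0 < K\<close> by auto
  next
    case (Suc k)
    then obtain N where N: "N \<le> M k" "x N < K - real k * (\<epsilon> / 2)" by auto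
    obtain n where n: "n \<le> \<Gamma> (\<epsilon> / 2) g N" and
      upper: "\<And>i. i \<in> {n..n + g n} \<Longrightarrow> x i \<le> x N + \<epsilon> / 2"
      using assms(3)[rule_format, OF half_gt_zero[OF \<open>0 < \<epsilon>\<close>]] by blast
    have n_le: "n \<le> ?G (M k)"
      using n functional_star_ge[OF N(1), of \<Gamma> "\<epsilon> / 2" g] by linarith
    \<comment> \<open>\<open>Phi K \<Gamma> \<epsilon> g\<close> is \<open>?G (M m)\<close>, and
      \<open>k \<le> m\<close>.\<close>
    also have "\<dots> \<le> Phi K \<Gamma> \<epsilon> g"
      using functional_star_mono[OF monoD[OF M_mono], of k m \<Gamma> "\<epsilon> / 2" g] Suc.prems
      by (simp add: Phi_def M_def m_def)
    finally obtain i j where ij: "i \<in> {n..n + g n}" "j \<in> {n..n + g n}" "\<bar>x i - x j\<bar> > \<epsilon>"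
      using unstable by (meson not_le)
    \<comment> \<open>Take for \<open>l\<close> the index of the smaller value: the larger one is at
      most \<open>x N + \<epsilon> / 2\<close>, and the gap exceeds
      \<open>\<epsilon>\<close>.\<close>
    obtain l where l: "l \<in> {n..n + g n}" "x l < x N - \<epsilon> / 2"
    proof (cases "x i \<le> x j")
      case True
      then show ?thesis using upper[OF ij(2)] ij(3) by (intro that[OF ij(1)]) linarith
    next
      case False
      then show ?thesis using upper[OF ij(1)] ij(3) by (intro that[OF ij(2)]) linarith
    qed
    \<comment> \<open>Only \<open>n \<le> ?G (M k)\<close> is known and \<open>g\<close> may fail to
      be monotone, so \<open>g n\<close> is bounded through \<open>nat_star g\<close>.\<close>
    have "l \<le> M (Suc k)"
      using l(1) n_le nat_star_ge[OF n_le, of g] by (simp add: M_Suc)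
    moreover have "x l < K - real (Suc k) * (\<epsilon> / 2)"
      using l(2) N(2) by (simp add: field_simps)
    ultimately show ?case by blast
  qed
  \<comment> \<open>At \<open>k = m\<close> the drops add up to at least \<open>K\<close>, forcing
    \<open>x N < 0\<close>.\<close>
  then obtain N where "x N < K - real m * (\<epsilon> / 2)" by blast
  moreover have "K \<le> real m * (\<epsilon> / 2)"
  proof -
    have "2 * K / \<epsilon> \<le> real m" unfolding m_def by (rule real_nat_ceiling_ge)
    then show ?thesis using \<open>0 < \<epsilon>\<close> by (simp add: field_simps)
  qed
  ultimately show False using assms(1)[of N] by linarith
qed

end
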